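(* Let $\mathcal{A}$ be a prime $*$-algebra over $\mathbb{C}$ with unit $I$, let $P$ be a nontrivial projection in $\mathcal{A}$, and let $\Phi:\mathcal{A}\to\mathcal{A}$ be a map. Then $\Phi$ is a nonlinear mixed Jordan triple $*$-derivation on $\mathcal{A}$ if and only if $\Phi$ is an additive $*$-derivation.
   Context: For $A,B$ in a $*$-algebra $\mathcal{A}$ over $\mathbb{C}$, define $[A,B]_{*}=AB-BA^{*}$ and $A\bullet B=AB+BA^{*}$. A (not necessarily additive or linear) map $\Phi:\mathcal{A}\to\mathcal{A}$ is a nonlinear mixed Jordan triple $*$-derivation if $\Phi([A\bullet B, C]_{*})=[\Phi(A)\bullet B, C]_{*}+[A\bullet \Phi(B), C]_{*}+[A\bullet B, \Phi(C)]_{*}$ for all $A,B,C\in\mathcal{A}$. An additive $*$-derivation on $\mathcal{A}$ is an additive map $\Phi:\mathcal{A}\to\mathcal{A}$ (no homogeneity over $\mathbb{C}$ is assumed) such that $\Phi(AB)=\Phi(A)B+A\Phi(B)$ for all $A,B\in\mathcal{A}$ and $\Phi(A^{*})=\Phi(A)^{*}$ for all $A\in\mathcal{A}$. An algebra $\mathcal{A}$ is prime if, for $A,B\in\mathcal{A}$, $A\mathcal{A}B=\{0\}$ implies $A=0$ or $B=0$. A projection is an element $P$ with $P=P^{*}=P^{2}$; it is nontrivial if $P\neq 0$ and $P\neq I$. *)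

theory Defs
  imports Complex_Main
begin

(* The class ring_1 includes 0 \<noteq> 1; this excludes only the zero algebra, which has no
   nontrivial projection. *)
locale star_algebra = vector_space scale
  for scale :: "complex \<Rightarrow> 'a::ring_1 \<Rightarrow> 'a" +
  fixes star :: "'a \<Rightarrow> 'a"
  assumes scale_mult_left: "scale c A * B = scale c (A * B)"
    and scale_mult_right: "A * scale c B = scale c (A * B)"
    and star_add: "star (A + B) = star A + star B"
    and star_scale: "star (scale c A) = scale (cnj c) (star A)"
    and star_mult: "star (A * B) = star B * star A"
    and star_star: "star (star A) = A"

locale prime_star_algebra = star_algebra scale star
  for scale :: "complex \<Rightarrow> 'a::ring_1 \<Rightarrow> 'a" and star :: "'a \<Rightarrow> 'a" +
  assumes prime: "(\<forall>X::'a. A * X * B = 0) \<Longrightarrow> A = 0 \<or> B = 0"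

definition star_lie :: "('a::ring_1 \<Rightarrow> 'a) \<Rightarrow> 'a \<Rightarrow> 'a \<Rightarrow> 'a" where
  "star_lie star A B = A * B - B * star A"

definition star_jordan :: "('a::ring_1 \<Rightarrow> 'a) \<Rightarrow> 'a \<Rightarrow> 'a \<Rightarrow> 'a" where
  "star_jordan star A B = A * B + B * star A"

definition nonlinear_mixed_jordan_triple_star_derivation ::
    "('a::ring_1 \<Rightarrow> 'a) \<Rightarrow> ('a \<Rightarrow> 'a) \<Rightarrow> bool" where
  "nonlinear_mixed_jordan_triple_star_derivation star \<Phi> \<longleftrightarrow>
     (\<forall>A B C. \<Phi> (star_lie star (star_jordan star A B) C) =
        star_lie star (star_jordan star (\<Phi> A) B) C
        + star_lie star (star_jordan star A (\<Phi> B)) C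
        + star_lie star (star_jordan star A B) (\<Phi> C))"

definition additive_star_derivation :: "('a::ring_1 \<Rightarrow> 'a) \<Rightarrow> ('a \<Rightarrow> 'a) \<Rightarrow> bool" where
  "additive_star_derivation star \<Phi> \<longleftrightarrow>
     additive \<Phi> \<and>
     (\<forall>A B. \<Phi> (A * B) = \<Phi> A * B + A * \<Phi> B) \<and>
     (\<forall>A. \<Phi> (star A) = star (\<Phi> A))"

definition projection :: "('a::ring_1 \<Rightarrow> 'a) \<Rightarrow> 'a \<Rightarrow> bool" where
  "projection star P \<longleftrightarrow> P = star P \<and> P = P\<^sup>2"

definition nontrivial_projection :: "('a::ring_1 \<Rightarrow> 'a) \<Rightarrow> 'a \<Rightarrow> bool" where
  "nontrivial_projection star P \<longleftrightarrow> projection star P \<and> P \<noteq> 0 \<and> P \<noteq> 1"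

end

theory Submission
  imports Defs
begin

text \<open>
Write $[B,C] = BC - CB^*$ and let $T(A,B,C)$ be the mixed triple product; it is additive in each
argument, and $T(1/2,B,C) = [B,C]$. Hence a mixed triple derivation \<open>\<Phi>\<close> satisfies
\[ \Phi([B,C]) = T(\Phi(1/2),B,C) + [\Phi(B),C] + [B,\Phi(C)], \]
a Leibniz rule for the binary product up to a term that is biadditive in $B$ and $C$. The proof that
\<open>\<Phi>\<close> is a derivation rests on this twisted rule alone; the converse is an expansion of both sides.

Additivity. Because the right-hand side is biadditive apart from \<open>\<Phi>\<close>, the defect
$S = \Phi(A+B) - \Phi(A) - \Phi(B)$ satisfies $[D,S] = $ the defect of $[D,A]$ and $[D,B]$, and
likewise in the other slot. So if $[D,A] = 0$ or $[D,B] = 0$, then $[D,S] = 0$.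
For a self-adjoint $H$ and $D = iH$ this reads: if $HA + AH = 0$, then $HS + SH = 0$.
Taking for $H$ a projection $p$, its complement $q = 1 - p$, or $1 - 2p$ shows that \<open>\<Phi>\<close> is additive across
the Peirce corners $pXp$, $pXq$, $qXp$, $qXq$. Inside $pXq$, the sum $A + B$ appears as a Peirce
component of the single product $[p + A, q + B]$, so additivity across corners gives additivity
there (\<open>additive_offdiagonal_corner\<close>). Inside $pXp$, multiplication by
$pXq$ moves the defect into $pXq$, where it vanishes; primeness and $q \neq 0$ then
make it vanish itself (\<open>additive_diagonal_corner\<close>).

Leibniz rule. Once \<open>\<Phi>\<close> is additive, testing on the scalars $1/2$, $1$ and $i$ yields $\Phi(1/2) = 0$,
$\Phi(i) = 0$ and $\Phi(iX) = i\Phi(X)$. The twisted rule is now an honest one for $BC - CB^*$;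
replacing $B$ by $iB$ gives it also for $BC + CB^*$. Adding the two gives the ordinary Leibniz rule,
and putting $C = 1$ in the second gives $\Phi(B^*) = \Phi(B)^*$.
\<close>

section \<open>Scalars and involution\<close>

context star_algebra
begin

lemma star_zero: "star 0 = 0"
  using star_add[of 0 0] by simp

lemma star_minus: "star (- A) = - star A"
  using star_add[of A "- A"] by (simp add: star_zero eq_neg_iff_add_eq_0 add.commute)

lemma star_diff: "star (A - B) = star A - star B"
  using star_add[of A "- B"] by (simp add: star_minus)

lemma star_one: "star 1 = 1"
  by (metis mult_1_left mult_1_right star_mult star_star)

lemmas star_simps = star_add star_diff star_minus star_zero star_one star_mult star_star

lemma self_add_eq_0: "(A::'a) + A = 0 \<longleftrightarrow> A = 0"
proof
  assume "A + A = 0"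
  moreover have "A + A = scale 2 A"
    using scale_left_distrib[of 1 1 A] by simp
  ultimately show "A = 0" by simp
qed simp

definition half :: 'a where "half = scale (1/2) 1"

lemma half_central: "A * half = half * A"
  by (simp add: half_def scale_mult_left scale_mult_right)

lemma half_add_half: "half * A + half * A = A"
  using scale_left_distrib[of "1/2" "1/2" A]
  by (simp add: half_def scale_mult_left)

lemma star_half: "star half = half"
  by (simp add: half_def star_scale star_one)

definition imag :: 'a where "imag = scale \<i> 1"

lemma imag_central: "A * imag = imag * A"
  by (simp add: imag_def scale_mult_left scale_mult_right)

lemma imag_central': "A * (imag * B) = imag * (A * B)"
  by (metis imag_central mult.assoc)

lemma imag_imag: "imag * (imag * A) = - A"
  using scale_left_distrib[of "1" "-1" A]
  by (simp add: imag_def scale_mult_left eq_neg_iff_add_eq_0 add.commute)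

lemma star_imag: "star imag = - imag"
  using scale_left_distrib[of "\<i>" "-\<i>" 1]
  by (simp add: imag_def star_scale star_one eq_neg_iff_add_eq_0 add.commute)

lemma imag_mult_eq_0: "imag * A = 0 \<longleftrightarrow> A = 0"
  by (metis imag_imag mult_zero_right neg_equal_0_iff_equal)

lemma imag_cancel: "imag * A = imag * B \<longleftrightarrow> A = B"
  using imag_mult_eq_0[of "A - B"] by (simp add: right_diff_distrib)

abbreviation lie :: "'a \<Rightarrow> 'a \<Rightarrow> 'a" where "lie \<equiv> star_lie star"

abbreviation triple :: "'a \<Rightarrow> 'a \<Rightarrow> 'a \<Rightarrow> 'a" where
  "triple A B C \<equiv> lie (star_jordan star A B) C"

lemma lie_add_left: "lie (A + B) C = lie A C + lie B C"
  by (simp add: star_lie_def star_simps algebra_simps)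

lemma lie_add_right: "lie A (B + C) = lie A B + lie A C"
  by (simp add: star_lie_def algebra_simps)

lemma lie_diff_left: "lie (A - B) C = lie A C - lie B C"
  by (simp add: star_lie_def star_simps algebra_simps)

lemma lie_diff_right: "lie A (B - C) = lie A B - lie A C"
  by (simp add: star_lie_def algebra_simps)

lemma triple_add_middle: "triple A (B + C) D = triple A B D + triple A C D"
  by (simp add: star_lie_def star_jordan_def star_simps algebra_simps)

lemma triple_half: "triple half B C = lie B C"
  by (simp add: star_jordan_def star_half half_central half_add_half)

text \<open>The involution turns the factor $i$ into $-i$, so multiplication by $i$ exchanges the two
binary products of the algebra; for self-adjoint \<open>B\<close> the right-hand side is the Jordan product.\<close>
lemma lie_imag: "lie (imag * B) C = imag * (B * C + C * star B)"
  by (simp add: star_lie_def star_simps star_imag imag_central imag_central' algebra_simps)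

end

section \<open>Additivity\<close>

locale mixed_jordan_triple_derivation = prime_star_algebra scale star
  for scale :: "complex \<Rightarrow> 'a::ring_1 \<Rightarrow> 'a" and star :: "'a \<Rightarrow> 'a" +
  fixes \<Phi> :: "'a \<Rightarrow> 'a"
  assumes mixed: "nonlinear_mixed_jordan_triple_star_derivation star \<Phi>"
begin

lemma triple_rule:
  "\<Phi> (triple A B C) = triple (\<Phi> A) B C + triple A (\<Phi> B) C + triple A B (\<Phi> C)"
  using mixed unfolding nonlinear_mixed_jordan_triple_star_derivation_def by blast

text \<open>The first summand has \<open>\<Phi>\<close> only at the fixed element \<open>half\<close>, so it is biadditive in \<open>B\<close> and \<open>C\<close>
and cancels from every additivity defect.\<close>
lemma twisted_lie_rule:
  "\<Phi> (lie B C) = triple (\<Phi> half) B C + lie (\<Phi> B) C + lie B (\<Phi> C)"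
  using triple_rule[of half B C] by (simp only: triple_half)

lemma map_zero: "\<Phi> 0 = 0"
  using triple_rule[of 0 0 0] by (simp add: star_lie_def star_jordan_def star_simps)

definition defect :: "'a \<Rightarrow> 'a \<Rightarrow> 'a" where
  "defect A B = \<Phi> (A + B) - \<Phi> A - \<Phi> B"

lemma defect_zero_iff: "defect A B = 0 \<longleftrightarrow> \<Phi> (A + B) = \<Phi> A + \<Phi> B"
  by (simp add: defect_def algebra_simps)

lemma lie_defect_right: "lie D (defect A B) = defect (lie D A) (lie D B)"
  unfolding defect_def lie_add_right[symmetric] twisted_lie_rule
  by (simp add: lie_add_right lie_diff_right)

lemma lie_defect_left: "lie (defect A B) D = defect (lie A D) (lie B D)"
  unfolding defect_def lie_add_left[symmetric] twisted_lie_rule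
  by (simp add: lie_add_left lie_diff_left triple_add_middle)

lemma defect_zero_left [simp]: "defect 0 A = 0"
  and defect_zero_right [simp]: "defect A 0 = 0"
  by (simp_all add: defect_def map_zero)

lemma jordan_defect:
  assumes "star H = H"
  shows "imag * (H * defect A B + defect A B * H) =
    defect (imag * (H * A + A * H)) (imag * (H * B + B * H))"
  using lie_defect_right[of "imag * H" A B] by (simp only: lie_imag assms)

lemma jordan_defect_vanishes:
  assumes "star H = H" and "H * A + A * H = 0 \<or> H * B + B * H = 0"
  shows "H * defect A B + defect A B * H = 0"
proof -
  have "imag * (H * defect A B + defect A B * H) = 0"
    using jordan_defect[OF assms(1), of A B] assms(2) by fastforce
  then show ?thesis by (simp only: imag_mult_eq_0)
qed

text \<open>Both $A$ and $B$ anticommute with the symmetry $1 - 2p$, which forces $S = pS + Sp$ for the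
defect $S$. The products $[A,p]$ and $[B,q]$ vanish, which forces $S$ to be self-adjoint and to
commute with $p$. These two properties are compatible only with $S = 0$.\<close>
lemma additive_offdiagonal:
  assumes p: "projection star p"
    and A: "p * A = A" "A * p = 0" and B: "p * B = 0" "B * p = B"
  shows "\<Phi> (A + B) = \<Phi> A + \<Phi> B"
proof -
  define S where "S = defect A B"
  have sp: "star p = p" using p by (simp add: projection_def)
  have pp: "p * p = p" using p by (simp add: projection_def power2_eq_square)
  have A': "p * star A = 0" "star A * p = star A" and B': "star B * p = 0" "p * star B = star B"
    using arg_cong[OF A(1), of star] arg_cong[OF A(2), of star]
      arg_cong[OF B(1), of star] arg_cong[OF B(2), of star]
    by (simp_all add: star_simps sp)
  have "lie S p = 0"
    unfolding S_def lie_defect_left by (simp add: star_lie_def A A')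
  then have c1: "S * p = p * star S" by (simp add: star_lie_def)
  have "lie S (1 - p) = 0"
    unfolding S_def lie_defect_left by (simp add: star_lie_def algebra_simps B B')
  then have "S - S * p = star S - p * star S" by (simp add: star_lie_def algebra_simps)
  with c1 have "star S = S" by simp
  with c1 have c2: "S * p = p * S" by simp
  have "(1 - (p + p)) * S + S * (1 - (p + p)) = 0"
    unfolding S_def
    by (rule jordan_defect_vanishes) (simp_all add: star_simps sp algebra_simps A)
  then have "(S - (p * S + p * S)) + (S - (p * S + p * S)) = 0"
    by (simp add: algebra_simps c2)
  then have c3: "S = p * S + p * S"
    unfolding self_add_eq_0 by simp
  have "p * S = p * (p * S + p * S)" using c3 by simp
  then have "p * S = 0" by (simp add: distrib_left pp flip: mult.assoc)
  with c3 have "S = 0" by simp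
  then show ?thesis by (simp add: S_def defect_zero_iff)
qed

text \<open>The hypothesis on \<open>M\<close> describes the off-diagonal elements $pXq + qYp$ by one linear equation.
The complement $1 - p$ kills the diagonal part and the symmetry $1 - 2p$ kills \<open>M\<close>.\<close>
lemma additive_corner_offdiagonal:
  assumes p: "projection star p"
    and A: "p * A = A" "A * p = A" and M: "p * M + M * p = M"
  shows "\<Phi> (A + M) = \<Phi> A + \<Phi> M"
proof -
  define S where "S = defect A M"
  have sp: "star p = p" using p by (simp add: projection_def)
  have "(1 - p) * S + S * (1 - p) = 0"
    unfolding S_def
    by (rule jordan_defect_vanishes) (simp_all add: star_simps sp algebra_simps A)
  then have c1: "S + S = p * S + S * p" by (simp add: algebra_simps)
  have "(1 - (p + p)) * S + S * (1 - (p + p)) = 0"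
    unfolding S_def
  proof (rule jordan_defect_vanishes)
    have "(1 - (p + p)) * M + M * (1 - (p + p)) = (M + M) - ((p * M + M * p) + (p * M + M * p))"
      by (simp add: algebra_simps)
    then show "(1 - (p + p)) * A + A * (1 - (p + p)) = 0 \<or> (1 - (p + p)) * M + M * (1 - (p + p)) = 0"
      by (simp add: M)
  qed (simp add: star_simps sp)
  then have "(S + S) = (p * S + S * p) + (p * S + S * p)" by (simp add: algebra_simps)
  with c1 have "S + S = 0" by simp
  then show ?thesis by (simp add: self_add_eq_0 S_def defect_zero_iff)
qed

lemma projection_complement: "projection star p \<Longrightarrow> projection star (1 - p)"
  by (simp add: projection_def star_simps power2_eq_square algebra_simps)

text \<open>The Jordan product with $p$ kills \<open>B\<close>. The Jordan product with $1 - p$ kills \<open>A\<close>, fixes \<open>M\<close> and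
doubles \<open>B\<close>, so that the defect that it produces is that of an off-diagonal and a diagonal element and
vanishes by the two-term case. The two resulting equations for the defect $S$ of $A + M$ and $B$
add up to $2S = 0$.\<close>
lemma additive_peirce:
  assumes p: "projection star p"
    and A: "p * A = A" "A * p = A" and M: "p * M + M * p = M" and B: "p * B = 0" "B * p = 0"
  shows "\<Phi> (A + M + B) = \<Phi> A + \<Phi> M + \<Phi> B"
proof -
  define S where "S = defect (A + M) B"
  have sp: "star p = p" using p by (simp add: projection_def)
  have c1: "p * S + S * p = 0"
    unfolding S_def by (rule jordan_defect_vanishes) (simp_all add: sp B)
  have e1: "(1 - p) * (A + M) + (A + M) * (1 - p) = M"
    using M by (simp add: algebra_simps A)
  have e2: "(1 - p) * B + B * (1 - p) = B + B" by (simp add: algebra_simps B)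
  have "\<Phi> (imag * (B + B) + imag * M) = \<Phi> (imag * (B + B)) + \<Phi> (imag * M)"
  proof (rule additive_corner_offdiagonal[OF projection_complement[OF p]])
    have "(1 - p) * (imag * M) + imag * M * (1 - p) = imag * (M + M - (p * M + M * p))"
      by (simp add: algebra_simps imag_central')
    then show "(1 - p) * (imag * M) + imag * M * (1 - p) = imag * M" by (simp add: M)
  qed (simp_all add: algebra_simps imag_central' B)
  then have "defect (imag * M) (imag * (B + B)) = 0"
    by (simp add: defect_zero_iff add.commute)
  then have "imag * ((1 - p) * S + S * (1 - p)) = 0"
    using jordan_defect[of "1 - p" "A + M" B] by (simp only: e1 e2 S_def star_simps sp)
  then have "(1 - p) * S + S * (1 - p) = 0" by (simp only: imag_mult_eq_0)
  then have "S + S = p * S + S * p" by (simp add: algebra_simps)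
  with c1 have "S = 0" by (simp add: self_add_eq_0)
  then show ?thesis
    using additive_corner_offdiagonal[OF p A M] by (simp add: S_def defect_zero_iff)
qed

text \<open>With $q = 1 - p$ we have $[p + A, q + B] = (A + B) - A^* - BA^*$, whose parts lie in the three
different corners $pXq$, $qXp$ and $pXp$. Evaluating \<open>\<Phi>\<close> on the left by the twisted rule, which
separates the two sums $p + A$ and $q + B$, and on the right corner by corner, isolates
$\Phi(A + B)$.\<close>
lemma additive_offdiagonal_corner:
  assumes p: "projection star p"
    and A: "p * A = A" "A * p = 0" and B: "p * B = B" "B * p = 0"
  shows "\<Phi> (A + B) = \<Phi> A + \<Phi> B"
proof -
  define q where "q = 1 - p"
  have sp: "star p = p" using p by (simp add: projection_def)
  have pp: "p * p = p" using p by (simp add: projection_def power2_eq_square)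
  have A': "p * star A = 0" "star A * p = star A"
    using arg_cong[OF A(1), of star] arg_cong[OF A(2), of star] by (simp_all add: star_simps sp)
  have [simp]: "p * (B * X) = B * X" for X by (metis B(1) mult.assoc)
  have AB: "A * B = 0" by (metis A(2) B(1) mult.assoc mult_zero_left)
  have sum: "\<Phi> (lie (p + A) (q + B)) = \<Phi> (lie p q) + \<Phi> (lie p B) + \<Phi> (lie A q) + \<Phi> (lie A B)"
  proof -
    have "\<Phi> (p + A) = \<Phi> p + \<Phi> A"
      by (rule additive_corner_offdiagonal[OF p]) (simp_all add: pp A)
    moreover have "\<Phi> (q + B) = \<Phi> q + \<Phi> B"
      by (rule additive_corner_offdiagonal[OF projection_complement[OF p]])
        (simp_all add: q_def pp B algebra_simps)
    ultimately have "\<Phi> (lie (p + A) (q + B)) =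
      triple (\<Phi> half) (p + A) (q + B) + lie (\<Phi> p + \<Phi> A) (q + B) + lie (p + A) (\<Phi> q + \<Phi> B)"
      by (simp only: twisted_lie_rule)
    then show ?thesis
      unfolding twisted_lie_rule[of p q] twisted_lie_rule[of p B]
        twisted_lie_rule[of A q] twisted_lie_rule[of A B]
      by (simp add: lie_add_left lie_add_right triple_add_middle add_ac)
  qed
  have lies: "lie p q = 0" "lie p B = B" "lie A q = A - star A" "lie A B = - (B * star A)"
    by (simp_all add: star_lie_def q_def sp pp A A' B AB algebra_simps)
  have "\<Phi> (A - star A) = \<Phi> A + \<Phi> (- star A)"
    using additive_offdiagonal[OF p A, of "- star A"] by (simp add: A')
  moreover have "lie (p + A) (q + B) = A + B - star A - B * star A"
    by (simp add: lie_add_left lie_add_right lies)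
  ultimately have expand:
    "\<Phi> (A + B - star A - B * star A) = \<Phi> A + \<Phi> B + \<Phi> (- star A) + \<Phi> (- (B * star A))"
    using sum by (simp only: lies map_zero) (simp add: add_ac)
  have "\<Phi> (- (B * star A) + (A + B - star A)) = \<Phi> (- (B * star A)) + \<Phi> (A + B - star A)"
    by (rule additive_corner_offdiagonal[OF p]) (simp_all add: algebra_simps A A' B)
  moreover have "\<Phi> ((A + B) + (- star A)) = \<Phi> (A + B) + \<Phi> (- star A)"
    by (rule additive_offdiagonal[OF p]) (simp_all add: algebra_simps A A' B)
  ultimately show ?thesis using expand by (simp add: algebra_simps)
qed

text \<open>The complement $1 - p$ kills \<open>A\<close> and \<open>B\<close>, so the defect $S$ lies in the same corner. For
elements of this corner $[Z, pX(1-p)] = ZX(1-p)$, hence $SX(1-p)$ is a defect of two elements of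
an off-diagonal corner. It is zero for all $X$, and primeness applies.\<close>
lemma additive_diagonal_corner:
  assumes p: "projection star p" and "p \<noteq> 1"
    and A: "p * A = A" "A * p = A" and B: "p * B = B" "B * p = B"
  shows "\<Phi> (A + B) = \<Phi> A + \<Phi> B"
proof -
  define S where "S = defect A B"
  have sp: "star p = p" using p by (simp add: projection_def)
  have pp: "p * p = p" using p by (simp add: projection_def power2_eq_square)
  have "(1 - p) * S + S * (1 - p) = 0"
    unfolding S_def
    by (rule jordan_defect_vanishes) (simp_all add: star_simps sp algebra_simps A)
  then have c1: "S + S = p * S + S * p" by (simp add: algebra_simps)
  have "p * S + p * S = p * S + p * S * p"
    using arg_cong[OF c1, of "\<lambda>x. p * x"] by (simp add: distrib_left pp flip: mult.assoc)
  moreover have "S * p + S * p = p * S * p + S * p"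
    using arg_cong[OF c1, of "\<lambda>x. x * p"] by (simp add: distrib_right pp mult.assoc)
  ultimately have "S * p = p * S" by simp
  with c1 have "(S - S * p) + (S - S * p) = 0" by (simp add: algebra_simps)
  then have Sp: "S * p = S" unfolding self_add_eq_0 by simp
  have Sp': "p * star S = star S" and A': "p * star A = star A" and B': "p * star B = star B"
    using arg_cong[OF Sp, of star] arg_cong[OF A(2), of star] arg_cong[OF B(2), of star]
    by (simp_all add: star_simps sp)
  have corner: "lie Z (p * X * (1 - p)) = Z * X * (1 - p)"
    if "Z * p = Z" "p * star Z = star Z" for Z X
    using that by (simp add: star_lie_def mult.assoc algebra_simps) (simp flip: mult.assoc)
  have "S * X * (1 - p) = 0" for X
  proof -
    have "lie S (p * X * (1 - p)) = defect (A * X * (1 - p)) (B * X * (1 - p))"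
      unfolding S_def lie_defect_left by (simp add: corner A A' B B')
    also have "\<dots> = 0"
      unfolding defect_zero_iff
    proof (rule additive_offdiagonal_corner[OF p])
      show "p * (A * X * (1 - p)) = A * X * (1 - p)" "p * (B * X * (1 - p)) = B * X * (1 - p)"
        by (simp_all add: A B flip: mult.assoc)
      show "A * X * (1 - p) * p = 0" "B * X * (1 - p) * p = 0"
        by (simp_all add: mult.assoc left_diff_distrib pp)
    qed
    finally show ?thesis by (simp add: corner Sp Sp')
  qed
  then have "S = 0 \<or> 1 - p = 0" using prime by blast
  with \<open>p \<noteq> 1\<close> show ?thesis by (simp add: S_def defect_zero_iff)
qed

text \<open>Primeness enters only through the diagonal corners; there are two of them, for $P$ and $1 - P$,
so the projection must differ from both $1$ and $0$.\<close>
lemma additive_map: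
  assumes P: "nontrivial_projection star P"
  shows "\<Phi> (X + Y) = \<Phi> X + \<Phi> Y"
proof -
  define Q where "Q = 1 - P"
  have p: "projection star P" "P \<noteq> 0" "P \<noteq> 1" using P by (simp_all add: nontrivial_projection_def)
  have q: "projection star Q" "Q \<noteq> 1" using p projection_complement by (auto simp: Q_def)
  have pp: "P * P = P" using p by (simp add: projection_def power2_eq_square)
  have ann: "Q * Q = Q" "P * Q = 0" "Q * P = 0" by (simp_all add: Q_def algebra_simps pp)
  have ext: "P * (P * Z) = P * Z" "Q * (Q * Z) = Q * Z" "P * (Q * Z) = 0" "Q * (P * Z) = 0" for Z
    by (simp_all add: pp ann flip: mult.assoc)
  note ps = pp ann ext mult.assoc distrib_left distrib_right
  have decomp: "\<Phi> Z = \<Phi> (P * Z * P) + (\<Phi> (P * Z * Q) + \<Phi> (Q * Z * P)) + \<Phi> (Q * Z * Q)" for Z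
  proof -
    have Z: "Z = P * Z * P + (P * Z * Q + Q * Z * P) + Q * Z * Q"
      by (simp add: Q_def algebra_simps)
    have "\<Phi> Z = \<Phi> (P * Z * P) + \<Phi> (P * Z * Q + Q * Z * P) + \<Phi> (Q * Z * Q)"
      by (subst Z, rule additive_peirce[OF p(1)]) (simp_all add: ps)
    also have "\<Phi> (P * Z * Q + Q * Z * P) = \<Phi> (P * Z * Q) + \<Phi> (Q * Z * P)"
      by (rule additive_offdiagonal[OF p(1)]) (simp_all add: ps)
    finally show ?thesis .
  qed
  have "\<Phi> (P * X * P + P * Y * P) = \<Phi> (P * X * P) + \<Phi> (P * Y * P)"
    by (rule additive_diagonal_corner[OF p(1,3)]) (simp_all add: ps)
  moreover have "\<Phi> (P * X * Q + P * Y * Q) = \<Phi> (P * X * Q) + \<Phi> (P * Y * Q)"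
    by (rule additive_offdiagonal_corner[OF p(1)]) (simp_all add: ps)
  moreover have "\<Phi> (Q * X * P + Q * Y * P) = \<Phi> (Q * X * P) + \<Phi> (Q * Y * P)"
    by (rule additive_offdiagonal_corner[OF q(1)]) (simp_all add: ps)
  moreover have "\<Phi> (Q * X * Q + Q * Y * Q) = \<Phi> (Q * X * Q) + \<Phi> (Q * Y * Q)"
    by (rule additive_diagonal_corner[OF q]) (simp_all add: ps)
  ultimately show ?thesis
    unfolding decomp[of X] decomp[of Y] decomp[of "X + Y"]
    by (simp add: distrib_left distrib_right)
qed

section \<open>The Leibniz rule\<close>

text \<open>Since $[1/2, C] = 0$ for all $C$, the twisted rule for $[1/2, 1]$ reduces to $[w + w^*, 1]/2 + [w, 1] = 0$
for $w = \Phi(1/2)$. The first summand is the product of a self-adjoint element with $1$ and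
vanishes, and the second is $w - w^*$.\<close>
lemma star_map_half: "star (\<Phi> half) = \<Phi> half"
proof -
  define w where "w = \<Phi> half"
  have lie_half: "lie half Z = 0" for Z
    by (simp add: star_lie_def star_half half_central)
  have "triple w half 1 + lie w 1 = 0"
    using twisted_lie_rule[of half 1] by (simp add: lie_half map_zero w_def)
  moreover have "triple w half 1 = 0"
    by (simp add: star_lie_def star_jordan_def star_simps star_half half_central algebra_simps)
  ultimately show ?thesis by (simp add: star_lie_def w_def)
qed

text \<open>For $w = \Phi(1/2)$, which is self-adjoint, and $v = \Phi(i)$, the product $[i, 1] = 2i$ gives
$v + v^* = 8iw$. The left-hand side is self-adjoint and the right-hand side is skew, so both vanish.\<close>
lemma map_half:
  assumes add: "\<And>X Y. \<Phi> (X + Y) = \<Phi> X + \<Phi> Y"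
  shows "\<Phi> half = 0"
proof -
  define w where "w = \<Phi> half"
  define v where "v = \<Phi> imag"
  have sw: "star w = w" by (simp add: w_def star_map_half)
  have one: "\<Phi> 1 = w + w" using add[of half half] half_add_half[of 1] by (simp add: w_def)
  \<comment> \<open>four times $iw$; written as repeated doubling, which can be cancelled\<close>
  define k where "k = imag * w + imag * w + imag * w + imag * w"
  have "\<Phi> (lie imag 1) = triple w imag 1 + lie v 1 + lie imag (w + w)"
    unfolding twisted_lie_rule[of imag 1] one by (simp add: w_def v_def)
  moreover have "\<Phi> (lie imag 1) = v + v"
    using add[of imag imag] by (simp add: star_lie_def star_imag v_def)
  moreover have "triple w imag 1 = k"
    by (simp add: star_lie_def star_jordan_def star_simps sw star_imag imag_central k_def
        algebra_simps)
  moreover have "lie imag (w + w) = k"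
    by (simp add: star_lie_def star_imag imag_central k_def algebra_simps)
  ultimately have "v + v = k + (v - star v) + k" by (simp add: star_lie_def)
  then have e: "v + star v = k + k" by (simp add: algebra_simps)
  have "star k = - k"
    by (simp add: k_def star_simps star_imag sw imag_central algebra_simps)
  moreover have "star (k + k) = k + k" by (metis e star_add star_star add.commute)
  ultimately have "k + k = - (k + k)" by (simp add: star_simps)
  then have "(k + k) + (k + k) = 0" by (simp only: eq_neg_iff_add_eq_0)
  then have "k = 0" by (simp only: self_add_eq_0)
  then have "((imag * w + imag * w) + (imag * w + imag * w)) = 0"
    by (simp add: k_def algebra_simps)
  then show ?thesis by (simp only: self_add_eq_0 imag_mult_eq_0 w_def)
qed

text \<open>Putting $C = 1$ and $C = i$ in the rule for $[i, C]$ shows that $v = \Phi(i)$ is skew and that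
$4iv = 0$. Then $\Phi$ commutes with multiplication by $i$, and the rule for $[iB, C] = i(BC + CB^*)$
complements that for $[B, C] = BC - CB^*$.\<close>
lemma derivation_of_additive:
  assumes add: "\<And>X Y. \<Phi> (X + Y) = \<Phi> X + \<Phi> Y"
  shows "additive_star_derivation star \<Phi>"
proof -
  have rule: "\<Phi> (lie B C) = lie (\<Phi> B) C + lie B (\<Phi> C)" for B C
    unfolding twisted_lie_rule[of B C] map_half[OF add]
    by (simp add: star_lie_def star_jordan_def star_simps)
  have one: "\<Phi> 1 = 0" using add[of half half] half_add_half[of 1] by (simp add: map_half[OF add])
  define v where "v = \<Phi> imag"
  have double: "\<Phi> (imag * C) + \<Phi> (imag * C) = v * C - C * star v + (imag * \<Phi> C + imag * \<Phi> C)" for C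
    using rule[of imag C] add[of "imag * C" "imag * C"]
    by (simp add: star_lie_def star_imag imag_central v_def algebra_simps)
  have sv: "star v = - v"
    using double[of 1] by (simp add: one v_def[symmetric] eq_neg_iff_add_eq_0 add.commute)
  have neg: "\<Phi> (- X) = - \<Phi> X" for X
    using add[of X "- X"] by (simp add: map_zero eq_neg_iff_add_eq_0 add.commute)
  have "imag * v + imag * v + (imag * v + imag * v) = 0"
    using double[of imag] imag_imag[of 1]
    by (simp add: sv neg one imag_central[of v] v_def[symmetric])
  then have "v = 0" by (simp only: self_add_eq_0 imag_mult_eq_0)
  then have "(\<Phi> (imag * C) - imag * \<Phi> C) + (\<Phi> (imag * C) - imag * \<Phi> C) = 0" for C
    using double[of C] by (simp add: star_zero algebra_simps)
  then have linear: "\<Phi> (imag * C) = imag * \<Phi> C" for C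
    unfolding self_add_eq_0 by simp
  have minus: "\<Phi> (B * C - C * star B) = \<Phi> B * C - C * star (\<Phi> B) + (B * \<Phi> C - \<Phi> C * star B)" for B C
    using rule[of B C] by (simp add: star_lie_def)
  have plus: "\<Phi> (B * C + C * star B) = \<Phi> B * C + C * star (\<Phi> B) + (B * \<Phi> C + \<Phi> C * star B)" for B C
    using rule[of "imag * B" C]
    by (simp add: linear lie_imag imag_cancel flip: distrib_left)
  have leibniz: "\<Phi> (B * C) = \<Phi> B * C + B * \<Phi> C" for B C
  proof -
    have "\<Phi> (B * C) + \<Phi> (B * C) = \<Phi> (B * C + C * star B) + \<Phi> (B * C - C * star B)"
      by (simp flip: add)
    then have "(\<Phi> (B * C) - (\<Phi> B * C + B * \<Phi> C)) + (\<Phi> (B * C) - (\<Phi> B * C + B * \<Phi> C)) = 0"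
      unfolding plus minus by (simp add: algebra_simps)
    then show ?thesis unfolding self_add_eq_0 by simp
  qed
  have "\<Phi> (star B) = star (\<Phi> B)" for B
    using plus[of B 1] by (simp add: one add)
  with leibniz add show ?thesis
    by (simp add: additive_star_derivation_def additive_def)
qed

end

lemma (in star_algebra) mixed_of_derivation:
  assumes "additive_star_derivation star \<Phi>"
  shows "nonlinear_mixed_jordan_triple_star_derivation star \<Phi>"
proof -
  interpret additive \<Phi> using assms by (simp add: additive_star_derivation_def)
  show ?thesis
    using assms
    by (simp add: additive_star_derivation_def nonlinear_mixed_jordan_triple_star_derivation_def
        star_lie_def star_jordan_def star_simps add diff algebra_simps)
qed

theorem corollary3p1:
  fixes scale :: "complex \<Rightarrow> 'a::ring_1 \<Rightarrow> 'a"
    and star :: "'a \<Rightarrow> 'a"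
    and P :: 'a
    and \<Phi> :: "'a \<Rightarrow> 'a"
  assumes "prime_star_algebra scale star"
    and "nontrivial_projection star P"
  shows "nonlinear_mixed_jordan_triple_star_derivation star \<Phi> \<longleftrightarrow>
         additive_star_derivation star \<Phi>"
proof
  assume "nonlinear_mixed_jordan_triple_star_derivation star \<Phi>"
  then interpret mixed_jordan_triple_derivation scale star \<Phi>
    by (intro mixed_jordan_triple_derivation.intro assms(1)
        mixed_jordan_triple_derivation_axioms.intro)
  show "additive_star_derivation star \<Phi>"
    by (rule derivation_of_additive, rule additive_map, rule assms(2))
next
  interpret prime_star_algebra scale star by (rule assms(1))
  assume "additive_star_derivation star \<Phi>"
  then show "nonlinear_mixed_jordan_triple_star_derivation star \<Phi>" by (rule mixed_of_derivation)
qed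

end
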